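(* For every positive integer $d$, there is a tree $T_d$ with maximum degree $5$ such that some vertex of $T_d$ can acquire weight at least $d$ via a sequence of unit acquisition moves starting from the configuration in which every vertex has weight $1$, and such that $a_u(T_d)=1$.
   Context: Graphs are finite, simple and undirected. The vertices of a graph carry nonnegative integer weights. A unit acquisition move transfers one unit of weight from a vertex $u$ of positive weight to a neighbor $v$ of $u$, under the condition that before the move the weight of $v$ is at least the weight of $u$. The unit acquisition number $a_u(G)$ of a graph $G$ is the minimum size to which the set of vertices with positive weight can be reduced via successive unit acquisition moves, starting from the configuration in which every vertex has weight $1$. *)

theory Defs
  imports "Graph_Theory.Graph_Theory"
begin

text \<open>
  A finite simple undirected graph is a symmetric digraph satisfying \<^locale>\<open>graph\<close>: an
  undirected edge \<open>uv\<close> is represented by the two arcs \<open>u \<rightarrow> v\<close> and \<open>v \<rightarrow> u\<close>.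
  For such a digraph \<^const>\<open>out_degree\<close> is the usual degree.

  The library's \<^const>\<open>tree\<close> is unsuitable here, since it counts the closed walk \<open>u, v, u\<close> as a
  cycle.  In a symmetric loop-free digraph without parallel arcs, the library cycles of length 2
  are exactly these back-and-forth walks, and those of length at least 3 are the (oriented,
  rooted) cycles of the undirected graph.
\<close>

definition undirected_tree :: "('a, 'b) pre_digraph \<Rightarrow> bool" where
  "undirected_tree G \<longleftrightarrow>
     graph G \<and> connected G \<and> \<not> (\<exists>p. pre_digraph.cycle G p \<and> length p \<ge> 3)"

definition max_degree :: "('a, 'b) pre_digraph \<Rightarrow> nat" where
  "max_degree G = Max (out_degree G ` verts G)"

definition unit_acquisition_move ::
    "('a, 'b) pre_digraph \<Rightarrow> ('a \<Rightarrow> nat) \<Rightarrow> ('a \<Rightarrow> nat) \<Rightarrow> bool" where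
  "unit_acquisition_move G w w' \<longleftrightarrow>
     (\<exists>u v. u \<rightarrow>\<^bsub>G\<^esub> v \<and> 0 < w u \<and> w u \<le> w v \<and> w' = w(u := w u - 1, v := w v + 1))"

text \<open>
  Weights are total functions; only their values on \<^term>\<open>verts G\<close> are meaningful, and moves
  never change the other values.
\<close>

definition unit_acquirable :: "('a, 'b) pre_digraph \<Rightarrow> ('a \<Rightarrow> nat) \<Rightarrow> bool" where
  "unit_acquirable G w \<longleftrightarrow> (unit_acquisition_move G)\<^sup>*\<^sup>* (\<lambda>_. 1) w"

definition unit_acquisition_number :: "('a, 'b) pre_digraph \<Rightarrow> nat" where
  "unit_acquisition_number G =
     (LEAST k. \<exists>w. unit_acquirable G w \<and> k = card {v \<in> verts G. 0 < w v})"

end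

theory Submission
  imports Defs
begin

text \<open>
  Call the weights on a rooted tree decreasing if every nonroot vertex of positive weight weighs
  strictly less than its parent.  From decreasing weights everything can be brought to the root:
  a unit travels from a positive vertex without positive children to the root, every edge of
  its path carrying one unit up, topmost edge first, and the weights stay decreasing
  (\<open>collect_at_root\<close>).  So it is enough to find trees of maximum degree 5 in which decreasing
  weights with an arbitrarily large root can be reached from the all-ones weights.

  Take a complete binary tree with \<open>n\<close> levels and attach two leaves to each of its vertices.
  Every inner vertex then has degree at most 5: a parent, two binary children and two leaves.
  Consider the weights in which a vertex on level \<open>i\<close> of the binary tree has weight
  \<open>max 1 (h - i)\<close>, and a leaf is still present exactly if its neighbour has weight 1; for \<open>h = 1\<close>
  these are the initial weights.  The heart of the proof is \<open>staircase_raise\<close>: if the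
  parent of the tree's root is heavier than \<open>h\<close>, then \<open>h\<close> can be raised to \<open>h + 1\<close>, and in doing
  so the tree also passes one unit up to that parent.  A vertex of weight 1 uses one leaf for the
  unit it sends and the other for its own growth.  A heavier vertex receives one unit from
  each of its two binary subtrees, sends the first one on and keeps the second one.  Thus each leaf
  is used exactly once, and the leaves hold just enough weight.  A recursive call never needs more
  than the parent being heavier than the child, which the staircase itself guarantees.

  Hanging the tree below an extra vertex, which first takes weight 2 from a leaf of its own, the raise
  can be performed for \<open>h = 1, \<dots>, n\<close>, since the extra vertex gains one unit each time.  It
  ends with weight \<open>n + 2\<close>, and the weights below it are decreasing.
\<close>

section \<open>Trees given by a parent function\<close>

text \<open>
  The vertex 0 serves as root, so only the other vertices are joined to their parents.
\<close>

definition parent_graph :: "(nat \<Rightarrow> nat) \<Rightarrow> nat set \<Rightarrow> (nat, nat \<times> nat) pre_digraph" where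
  "parent_graph p V =
     \<lparr>verts = V, arcs = {(x, y). x \<in> V \<and> y \<in> V \<and> (x \<noteq> 0 \<and> y = p x \<or> y \<noteq> 0 \<and> x = p y)},
      tail = fst, head = snd\<rparr>"

lemma parent_graph_simps [simp]:
  "verts (parent_graph p V) = V" "tail (parent_graph p V) = fst" "head (parent_graph p V) = snd"
  "(x, y) \<in> arcs (parent_graph p V) \<longleftrightarrow>
     x \<in> V \<and> y \<in> V \<and> (x \<noteq> 0 \<and> y = p x \<or> y \<noteq> 0 \<and> x = p y)"
  by (auto simp: parent_graph_def)

lemma dominates_parent_graph [simp]:
  "x \<rightarrow>\<^bsub>parent_graph p V\<^esub> y \<longleftrightarrow>
     x \<in> V \<and> y \<in> V \<and> (x \<noteq> 0 \<and> y = p x \<or> y \<noteq> 0 \<and> x = p y)"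
  by (auto simp: arcs_ends_conv image_iff)

lemma cas_tail_nth:
  assumes "pre_digraph.cas G u q v" "i < length q"
  shows "tail G (q ! i) = (if i = 0 then u else head G (q ! (i - 1)))"
  using assms
proof (induction q arbitrary: u i)
  case (Cons e q)
  then show ?case
    by (cases i) (auto simp: pre_digraph.cas.simps split: if_splits nat.splits)
qed simp

lemma cas_head_last:
  assumes "pre_digraph.cas G u q v" "q \<noteq> []"
  shows "head G (q ! (length q - 1)) = v"
  using assms
proof (induction q arbitrary: u)
  case (Cons e q)
  then show ?case
    by (cases q) (auto simp: pre_digraph.cas.simps)
qed simp

text \<open>
  Letting parents be smaller numbers gives induction towards the root, and makes the
  vertex with the largest number in any set a vertex without children in that set.
\<close>

locale parent_tree =
  fixes p :: "nat \<Rightarrow> nat" and V :: "nat set"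
  assumes finite_V: "finite V"
    and root_in_V: "0 \<in> V"
    and parent_in_V: "x \<in> V \<Longrightarrow> x \<noteq> 0 \<Longrightarrow> p x \<in> V"
    and parent_less: "x \<in> V \<Longrightarrow> x \<noteq> 0 \<Longrightarrow> p x < x"
begin

abbreviation "T \<equiv> parent_graph p V"

lemma graph_T: "graph T"
proof -
  have "arcs T \<subseteq> V \<times> V"
    by auto
  then have "finite (arcs T)"
    by (rule finite_subset) (simp add: finite_V)
  moreover have "\<exists>e'\<in>arcs T. fst e = snd e' \<and> snd e = fst e'" if "e \<in> arcs T" for e
    using that by (intro bexI[of _ "(snd e, fst e)"]; cases e) auto
  ultimately show ?thesis
    by unfold_locales
      (auto simp: finite_V arc_to_ends_def symmetric_conv dest!: parent_less)
qed

lemma root_reachable: "x \<in> V \<Longrightarrow> x \<rightarrow>\<^sup>*\<^bsub>T\<^esub> 0 \<and> 0 \<rightarrow>\<^sup>*\<^bsub>T\<^esub> x"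
proof (induction x rule: less_induct)
  case (less x)
  interpret graph T by (rule graph_T)
  show ?case
  proof (cases "x = 0")
    case False
    then have "p x \<rightarrow>\<^sup>*\<^bsub>T\<^esub> 0" "0 \<rightarrow>\<^sup>*\<^bsub>T\<^esub> p x"
      using less parent_in_V parent_less by auto
    moreover have "x \<rightarrow>\<^bsub>T\<^esub> p x" "p x \<rightarrow>\<^bsub>T\<^esub> x"
      using False less.prems parent_in_V by auto
    ultimately show ?thesis
      using adj_reachable_trans reachable_adj_trans by blast
  qed (simp add: root_in_V)
qed

lemma connected_T: "connected T"
proof -
  interpret graph T by (rule graph_T)
  have "x \<rightarrow>\<^sup>*\<^bsub>T\<^esub> y" if "x \<in> V" "y \<in> V" for x y
    using that root_reachable reachable_trans by blast
  then show ?thesis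
    using root_in_V unfolding connected_def strongly_connected_def
    by (auto simp: reachable_mk_symmetric_eq[OF sym_arcs])
qed

text \<open>
  The two neighbours on a cycle of its largest vertex are both smaller, hence both equal to its parent.
  On a cycle of length at least 3 they would have to be distinct.
\<close>

lemma no_long_cycle:
  assumes "pre_digraph.cycle T q" "length q \<ge> 3"
  shows False
proof -
  obtain u where walk: "pre_digraph.awalk T u q u"
    and dist: "distinct (tl (pre_digraph.awalk_verts T u q))"
    using assms(1) unfolding pre_digraph.cycle_def by blast
  have arcs: "set q \<subseteq> arcs T" and cas: "pre_digraph.cas T u q u"
    using walk unfolding pre_digraph.awalk_def by auto
  let ?L = "length q"
  have ne: "q \<noteq> []" using assms(2) by auto
  have dist_heads: "distinct (map snd q)"
    using dist ne unfolding pre_digraph.awalk_verts_conv'[OF cas] by simp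
  have arc: "fst (q ! i) \<in> V \<and> snd (q ! i) \<in> V \<and>
      (fst (q ! i) \<noteq> 0 \<and> snd (q ! i) = p (fst (q ! i)) \<or>
       snd (q ! i) \<noteq> 0 \<and> fst (q ! i) = p (snd (q ! i)))" if "i < ?L" for i
    using arcs nth_mem[OF that] by (cases "q ! i") auto
  have tail: "fst (q ! i) = (if i = 0 then snd (q ! (?L - 1)) else snd (q ! (i - 1)))"
    if "i < ?L" for i
    using cas_tail_nth[OF cas that] cas_head_last[OF cas ne] by auto
  let ?m = "Max (set (map snd q))"
  have "?m \<in> set (map snd q)"
    using ne by (intro Max_in) auto
  then obtain k where k: "k < ?L" "snd (q ! k) = ?m"
    by (auto simp: in_set_conv_nth)
  have le: "snd (q ! i) \<le> ?m" if "i < ?L" for i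
    using that by (intro Max_ge) auto
  \<comment> \<open>\<open>j\<close> and \<open>l\<close> are the cyclic predecessor and successor of \<open>k\<close>; they differ as the length is at least 3.\<close>
  define j where "j = (if k = 0 then ?L - 1 else k - 1)"
  define l where "l = (if k = ?L - 1 then 0 else k + 1)"
  have jl: "j < ?L" "l < ?L" "j \<noteq> l"
    using k(1) assms(2) by (auto simp: j_def l_def)
  have "fst (q ! k) = snd (q ! j)"
    using tail[OF k(1)] by (simp add: j_def)
  then have "snd (q ! j) = p ?m"
    using arc[OF k(1)] k(2) le[OF jl(1)] parent_less by fastforce
  moreover have "fst (q ! l) = ?m"
    using tail[OF jl(2)] k by (auto simp: l_def split: if_splits)
  then have "snd (q ! l) = p ?m"
    using arc[OF jl(2)] le[OF jl(2)] parent_less by fastforce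
  ultimately show False
    using dist_heads jl nth_eq_iff_index_eq[of "map snd q" j l] by simp
qed

lemma undirected_tree_T: "undirected_tree T"
  using graph_T connected_T no_long_cycle unfolding undirected_tree_def by blast

abbreviation "reaches \<equiv> (unit_acquisition_move T)\<^sup>*\<^sup>*"

lemma reaches_move: "unit_acquisition_move T w w' \<Longrightarrow> reaches w w'"
  by (rule r_into_rtranclp[where r = "unit_acquisition_move T"])

lemma reaches_trans: "reaches w w' \<Longrightarrow> reaches w' w'' \<Longrightarrow> reaches w w''"
  by (rule rtranclp_trans[where r = "unit_acquisition_move T"])

lemma reaches_acquirable: "unit_acquirable T w \<Longrightarrow> reaches w w' \<Longrightarrow> unit_acquirable T w'"
  unfolding unit_acquirable_def by (rule reaches_trans)

lemma move_up:
  assumes "x \<in> V" "x \<noteq> 0" "0 < w x" "w x \<le> w (p x)"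
  shows "unit_acquisition_move T w (w(x := w x - 1, p x := w (p x) + 1))"
  unfolding unit_acquisition_move_def using assms parent_in_V by auto

section \<open>Collecting all weight at the root\<close>

text \<open>
  Vertices of weight 0 are exempt, since exhausted vertices take no further part.
\<close>

definition decreasing :: "(nat \<Rightarrow> nat) \<Rightarrow> bool" where
  "decreasing w \<longleftrightarrow> (\<forall>x\<in>V. x \<noteq> 0 \<longrightarrow> w x = 0 \<or> w x < w (p x))"

text \<open>
  The parent sends a unit first.  Having been strictly heavier than \<open>x\<close>, it is afterwards still at
  least as heavy, so \<open>x\<close> can refill it.
\<close>

lemma send_unit_to_root:
  assumes "decreasing w" "x \<in> V" "x \<noteq> 0" "0 < w x"
  shows "reaches w (w(x := w x - 1, 0 := w 0 + 1))"
  using assms(2-)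
proof (induction x rule: less_induct)
  case (less x)
  have lt: "w x < w (p x)" "p x < x" "p x \<in> V"
    using less.prems assms(1) parent_less parent_in_V by (auto simp: decreasing_def)
  show ?case
  proof (cases "p x = 0")
    case True
    then have "unit_acquisition_move T w (w(x := w x - 1, 0 := w 0 + 1))"
      using move_up[of x w] less.prems lt by simp
    then show ?thesis
      by (rule reaches_move)
  next
    case False
    let ?w = "w(p x := w (p x) - 1, 0 := w 0 + 1)"
    have "0 < w (p x)"
      using lt by simp
    then have "reaches w ?w"
      by (rule less.IH[OF lt(2,3) False])
    moreover have "unit_acquisition_move T ?w (?w(x := ?w x - 1, p x := ?w (p x) + 1))"
      using less.prems lt False by (intro move_up) auto
    moreover have "?w(x := ?w x - 1, p x := ?w (p x) + 1) = w(x := w x - 1, 0 := w 0 + 1)"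
      using less.prems lt False by auto
    ultimately show ?thesis
      using reaches_move reaches_trans by metis
  qed
qed

lemma collect_at_root:
  assumes "decreasing w"
  shows "\<exists>w'. reaches w w' \<and> (\<forall>x\<in>V - {0}. w' x = 0)"
  using assms
proof (induction "sum w (V - {0})" arbitrary: w rule: less_induct)
  case less
  let ?P = "{x \<in> V - {0}. 0 < w x}"
  show ?case
  proof (cases "?P = {}")
    case True
    then show ?thesis by (intro exI[of _ w]) auto
  next
    case False
    \<comment> \<open>Children have larger numbers, so all children of the maximum \<open>x\<close> have weight 0; lowering
      \<open>x\<close> therefore keeps the weights decreasing.\<close>
    define x where "x = Max ?P"
    have fin: "finite ?P" using finite_V by simp
    have x: "x \<in> V" "x \<noteq> 0" "0 < w x"
      using Max_in[OF fin False] by (auto simp: x_def)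
    have max: "y \<le> x" if "y \<in> V" "y \<noteq> 0" "0 < w y" for y
      using Max_ge[OF fin, of y] that by (simp add: x_def)
    let ?w = "w(x := w x - 1, 0 := w 0 + 1)"
    have "decreasing ?w"
      unfolding decreasing_def
    proof (intro ballI impI)
      fix y assume y: "y \<in> V" "y \<noteq> 0"
      show "?w y = 0 \<or> ?w y < ?w (p y)"
      proof (cases "w y = 0")
        case False
        then have "p y \<noteq> x"
          using max[OF y] parent_less[OF y] by auto
        moreover have "w y < w (p y)"
          using less.prems y False by (auto simp: decreasing_def)
        ultimately show ?thesis
          using y by auto
      qed (use y in auto)
    qed
    moreover have "sum ?w (V - {0}) < sum w (V - {0})"
      using x finite_V by (intro sum_strict_mono_ex1) auto
    ultimately obtain w' where w': "reaches ?w w'" "\<forall>x\<in>V - {0}. w' x = 0"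
      using less.hyps[of ?w] by blast
    have "reaches w w'"
      using send_unit_to_root[OF less.prems x] w'(1) by (rule reaches_trans)
    then show ?thesis
      using w'(2) by blast
  qed
qed

text \<open>The receiver of the last move is positive, so the acquisition number cannot be 0.\<close>

lemma some_positive:
  assumes "unit_acquirable T w"
  shows "\<exists>x\<in>V. 0 < w x"
  using assms[unfolded unit_acquirable_def]
proof (induction rule: rtranclp_induct)
  case base
  then show ?case using root_in_V by auto
next
  case (step w w')
  then show ?case
    unfolding unit_acquisition_move_def by (auto simp del: One_nat_def)
qed

lemma acquisition_number_eq_1:
  assumes "unit_acquirable T w" "decreasing w"
  shows "unit_acquisition_number T = 1"
proof -
  obtain w' where w': "reaches w w'" "\<forall>x\<in>V - {0}. w' x = 0"
    using collect_at_root[OF assms(2)] by blast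
  then have acq: "unit_acquirable T w'"
    using assms(1) reaches_acquirable by blast
  have "{v \<in> verts T. 0 < w' v} = {0}"
    using some_positive[OF acq] w'(2) root_in_V by force
  then have "1 = card {v \<in> verts T. 0 < w' v}"
    by simp
  moreover have "1 \<le> card {v \<in> verts T. 0 < u v}" if "unit_acquirable T u" for u
    using some_positive[OF that] finite_V by (auto simp: Suc_le_eq card_gt_0_iff)
  ultimately show ?thesis
    unfolding unit_acquisition_number_def using acq
    by (intro Least_equality) blast+
qed

end

section \<open>The trees\<close>

text \<open>
  The vertices are numbered like a heap with four children \<open>4v + 1, \<dots>, 4v + 4\<close> per vertex \<open>v\<close>.  Of
  these, \<open>4v + 1\<close> and \<open>4v + 2\<close> are the attached leaves and \<open>4v + 3\<close> and \<open>4v + 4\<close> the binary children.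
\<close>

definition heap_parent :: "nat \<Rightarrow> nat" where
  "heap_parent x = (x - 1) div 4"

lemma heap_parent_child [simp]:
  "heap_parent (4 * v + 1) = v" "heap_parent (Suc (4 * v)) = v" "heap_parent (4 * v + 2) = v"
  "heap_parent (Suc (Suc (4 * v))) = v"
  "heap_parent (4 * v + 3) = v" "heap_parent (4 * v + 4) = v"
  by (auto simp: heap_parent_def)

lemma heap_parent_less: "x \<noteq> 0 \<Longrightarrow> heap_parent x < x"
  by (auto simp: heap_parent_def)

lemma heap_children:
  assumes "x \<noteq> 0" "heap_parent x = v"
  shows "x \<in> {4 * v + 1, 4 * v + 2, 4 * v + 3, 4 * v + 4}"
proof -
  have "x = 4 * v + 1 \<or> x = 4 * v + 2 \<or> x = 4 * v + 3 \<or> x = 4 * v + 4"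
    using assms unfolding heap_parent_def by presburger
  then show ?thesis by simp
qed

fun subtree :: "nat \<Rightarrow> nat \<Rightarrow> nat set" where
  "subtree 0 v = {}"
| "subtree (Suc n) v =
     {v, 4 * v + 1, 4 * v + 2} \<union> subtree n (4 * v + 3) \<union> subtree n (4 * v + 4)"

lemma finite_subtree [simp]: "finite (subtree n v)"
  by (induction n arbitrary: v) auto

lemma subtree_ge: "x \<in> subtree n v \<Longrightarrow> v \<le> x"
proof (induction n arbitrary: v)
  case (Suc n)
  then show ?case by (force dest: Suc.IH)
qed simp

lemma heap_parent_in_subtree:
  "x \<in> subtree n v \<Longrightarrow> x \<noteq> v \<Longrightarrow> heap_parent x \<in> subtree n v"
proof (induction n arbitrary: v)
  case (Suc n)
  then show ?case
    by (cases "x \<in> {4 * v + 3, 4 * v + 4}") auto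
qed simp

lemma subtree_iterate_parent: "x \<in> subtree n v \<Longrightarrow> \<exists>k. (heap_parent ^^ k) x = v"
proof (induction n arbitrary: v)
  case (Suc n)
  consider "x = v" | "x = 4 * v + 1 \<or> x = 4 * v + 2"
    | "x \<in> subtree n (4 * v + 3)" | "x \<in> subtree n (4 * v + 4)"
    using Suc.prems by auto
  then consider "x = v" | "heap_parent x = v"
    | u where "x \<in> subtree n u" "heap_parent u = v"
    by cases (use heap_parent_child in blast)+
  then show ?case
  proof cases
    case 1
    then show ?thesis by (intro exI[of _ 0]) simp
  next
    case 2
    then show ?thesis by (intro exI[of _ 1]) simp
  next
    case 3
    then obtain k where "(heap_parent ^^ k) x = u"
      using Suc.IH by blast
    then show ?thesis
      using 3 by (intro exI[of _ "Suc k"]) simp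
  qed
qed simp

lemma iterate_heap_parent_le: "(heap_parent ^^ k) x \<le> x"
proof (induction k)
  case (Suc k)
  have "heap_parent y \<le> y" for y by (simp add: heap_parent_def)
  from this[of "(heap_parent ^^ k) x"] show ?case using Suc by simp
qed simp

text \<open>
  An iterated parent of \<open>a\<close> other than \<open>a\<close> itself is at most the common parent, hence below \<open>b\<close>.
\<close>

lemma siblings_not_iterated_parents:
  assumes "heap_parent a = heap_parent b" "b \<noteq> 0" "(heap_parent ^^ k) a = b"
  shows "a = b"
proof (cases k)
  case (Suc i)
  then have "(heap_parent ^^ i) (heap_parent b) = b"
    using assms by (simp add: funpow_swap1)
  then show ?thesis
    using iterate_heap_parent_le[of i "heap_parent b"] heap_parent_less[OF assms(2)] by simp
qed (use assms in simp)

lemma sibling_subtrees_disjoint: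
  assumes "heap_parent a = heap_parent b" "a \<noteq> 0" "b \<noteq> 0" "a \<noteq> b"
  shows "subtree n a \<inter> subtree m b = {}"
proof (rule ccontr)
  assume "subtree n a \<inter> subtree m b \<noteq> {}"
  then obtain x k l where kl: "(heap_parent ^^ k) x = a" "(heap_parent ^^ l) x = b"
    using subtree_iterate_parent by blast
  then have "(heap_parent ^^ (l - k)) a = b \<or> (heap_parent ^^ (k - l)) b = a"
    using funpow_add[of "l - k" k heap_parent] funpow_add[of "k - l" l heap_parent]
    by (cases "k \<le> l") auto
  then show False
    using siblings_not_iterated_parents assms by metis
qed

text \<open>
  The extra vertex 0 above the binary tree, its leaf 1, and the binary tree rooted at 2.
\<close>

definition tree_vertices :: "nat \<Rightarrow> nat set" where
  "tree_vertices n = {0, 1} \<union> subtree n 2"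

lemma parent_tree_vertices: "parent_tree heap_parent (tree_vertices n)"
proof
  fix x assume x: "x \<in> tree_vertices n" "x \<noteq> 0"
  show "heap_parent x < x" using x heap_parent_less by simp
  show "heap_parent x \<in> tree_vertices n"
  proof (cases "x \<in> {1, 2}")
    case True
    then show ?thesis by (auto simp: tree_vertices_def heap_parent_def)
  next
    case False
    then show ?thesis
      using x heap_parent_in_subtree by (auto simp: tree_vertices_def)
  qed
qed (auto simp: tree_vertices_def)

lemma out_arcs_parent_graph:
  "out_arcs (parent_graph p V) x =
     {(x, y) |y. x \<in> V \<and> y \<in> V \<and> (x \<noteq> 0 \<and> y = p x \<or> y \<noteq> 0 \<and> x = p y)}"
  by (auto simp: out_arcs_def)

text \<open>
  The bound 5 is attained at vertex 2 as soon as it has binary children.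
\<close>

lemma max_degree_tree:
  assumes "n \<ge> 2"
  shows "max_degree (parent_graph heap_parent (tree_vertices n)) = 5"
proof -
  let ?G = "parent_graph heap_parent (tree_vertices n)"
  have "out_degree ?G x \<le> 5" for x
  proof -
    let ?N = "[heap_parent x, 4 * x + 1, 4 * x + 2, 4 * x + 3, 4 * x + 4]"
    have "y \<in> set ?N" if "x \<noteq> 0 \<and> y = heap_parent x \<or> y \<noteq> 0 \<and> x = heap_parent y" for y
      using that heap_children[of y x] by auto
    then have "out_arcs ?G x \<subseteq> Pair x ` set ?N"
      unfolding out_arcs_parent_graph by blast
    then have "out_arcs ?G x \<subseteq> set (map (Pair x) ?N)"
      unfolding set_map .
    then have "out_degree ?G x \<le> card (set (map (Pair x) ?N))"
      unfolding out_degree_def by (intro card_mono) auto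
    also have "\<dots> \<le> 5"
      using card_length[of "map (Pair x) ?N"] by simp
    finally show ?thesis .
  qed
  moreover have "out_degree ?G 2 = 5"
  proof -
    obtain m where m: "n = Suc (Suc m)"
      using assms by (metis add_2_eq_Suc le_Suc_ex)
    have "{0, 2, 9, 10, 11, 12} \<subseteq> tree_vertices n"
      by (auto simp: tree_vertices_def m)
    moreover have "heap_parent 2 = 0" "heap_parent 9 = 2" "heap_parent 10 = 2"
      "heap_parent 11 = 2" "heap_parent 12 = 2"
      by (auto simp: heap_parent_def)
    moreover have "y \<in> {9, 10, 11, 12}" if "y \<noteq> 0" "heap_parent y = 2" for y
      using heap_children[OF that] by simp
    ultimately have "out_arcs ?G 2 = Pair 2 ` {0, 9, 10, 11, 12}"
      unfolding out_arcs_parent_graph by auto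
    then show ?thesis
      by (simp add: out_degree_def card_image inj_on_def)
  qed
  moreover have "2 \<in> tree_vertices n"
    using assms by (cases n) (auto simp: tree_vertices_def)
  moreover have "finite (tree_vertices n)"
    by (simp add: tree_vertices_def)
  ultimately show ?thesis
    unfolding max_degree_def by (intro Max_eqI) (auto simp: image_iff intro: bexI[of _ 2])
qed

section \<open>Raising the weights level by level\<close>

text \<open>
  Along the levels of the binary tree the weights are \<open>h, h - 1, \<dots>, 2, 1, 1, \<dots>\<close>, and the leaves have
  been used exactly at the vertices of weight at least 2.  The value \<open>h = 0\<close> describes
  the same weights as \<open>h = 1\<close> and arises for the levels below the first vertex of weight 1.
\<close>

fun staircase :: "nat \<Rightarrow> nat \<Rightarrow> nat \<Rightarrow> (nat \<Rightarrow> nat) \<Rightarrow> bool" where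
  "staircase 0 h v w \<longleftrightarrow> True"
| "staircase (Suc n) h v w \<longleftrightarrow>
     w v = max 1 h \<and>
     w (4 * v + 1) = (if h \<le> 1 then 1 else 0) \<and> w (4 * v + 2) = (if h \<le> 1 then 1 else 0) \<and>
     staircase n (h - 1) (4 * v + 3) w \<and> staircase n (h - 1) (4 * v + 4) w"

lemma staircase_cong: "(\<And>x. x \<in> subtree n v \<Longrightarrow> w x = w' x) \<Longrightarrow> staircase n h v w \<longleftrightarrow> staircase n h v w'"
  by (induction n arbitrary: h v) auto

lemma staircase_0_eq_1: "staircase n 0 v w \<longleftrightarrow> staircase n (Suc 0) v w"
  by (cases n) auto

lemma staircase_initial: "staircase n (Suc 0) v (\<lambda>_. 1)"
  by (induction n arbitrary: v) (auto simp: staircase_0_eq_1)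

text \<open>
  Asking the subtree to send a unit to its parent, besides growing by itself, makes the
  induction close.  At weight \<open>h \<ge> 2\<close> the parts are applied in the order: right subtree, then the move from
  \<open>v\<close> to its parent, then left subtree.  Both subtrees find \<open>v\<close> at weight \<open>h\<close>, above their own \<open>h - 1\<close>, and
  \<open>v\<close> moves its unit when it has weight \<open>h + 1\<close>, which the parent is known to have at least.
\<close>

lemma staircase_raise:
  assumes "parent_tree heap_parent V"
    and "subtree n v \<subseteq> V" "v \<noteq> 0" "0 < h" "h \<le> n" "staircase n h v w" "h < w (heap_parent v)"
  shows "\<exists>w'. (unit_acquisition_move (parent_graph heap_parent V))\<^sup>*\<^sup>* w w' \<and>
    staircase n (Suc h) v w' \<and> w' (heap_parent v) = Suc (w (heap_parent v)) \<and>
    (\<forall>x. x \<notin> subtree n v \<longrightarrow> x \<noteq> heap_parent v \<longrightarrow> w' x = w x)"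
  using assms(2-)
proof (induction n arbitrary: h v w)
  case (Suc n)
  interpret parent_tree heap_parent V by (rule assms(1))
  let ?M = "unit_acquisition_move T"
  let ?p = "heap_parent v" and ?l = "4 * v + 3" and ?r = "4 * v + 4"
  have p: "?p < v"
    using heap_parent_less Suc.prems by simp
  have vV: "v \<in> V" "4 * v + 1 \<in> V" "4 * v + 2 \<in> V" "subtree n ?l \<subseteq> V" "subtree n ?r \<subseteq> V"
    using Suc.prems(1) by auto
  have disj: "subtree n ?l \<inter> subtree n ?r = {}"
    by (rule sibling_subtrees_disjoint) auto
  have outside: "y \<notin> subtree n ?l" "y \<notin> subtree n ?r" if "y \<le> 4 * v + 2" for y
    using that subtree_ge[of y n ?l] subtree_ge[of y n ?r] by auto
  show ?case
  proof (cases "h = 1")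
    case True
    let ?a = "4 * v + 1" and ?b = "4 * v + 2"
    have w: "w v = 1" "w ?a = 1" "w ?b = 1" "staircase n 0 ?l w" "staircase n 0 ?r w" "2 \<le> w ?p"
      using Suc.prems True by auto
    \<comment> \<open>The first leaf pays for the unit sent to the parent, the second for the growth of \<open>v\<close>.\<close>
    let ?w1 = "w(?a := 0, v := 2)"
    let ?w2 = "?w1(v := 1, ?p := w ?p + 1)"
    let ?w3 = "?w2(?b := 0, v := 2)"
    have "?M w ?w1"
      using move_up[OF vV(2), of w] w(1,2) by (simp add: numeral_2_eq_2)
    moreover have "?M ?w1 ?w2"
      using move_up[OF vV(1), of ?w1] w(6) p by simp
    moreover have "?M ?w2 ?w3"
      using move_up[OF vV(3), of ?w2] w(3) p by (simp add: numeral_2_eq_2)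
    ultimately have "reaches w ?w3"
      using reaches_move reaches_trans by blast
    moreover have "staircase n 1 ?l ?w3" "staircase n 1 ?r ?w3"
    proof -
      have "w x = ?w3 x" if "x \<in> subtree n ?l \<union> subtree n ?r" for x
        using that outside[of x] p by auto
      then show "staircase n 1 ?l ?w3" "staircase n 1 ?r ?w3"
        using w staircase_cong[of n ?l w ?w3] staircase_cong[of n ?r w ?w3] staircase_0_eq_1 by auto
    qed
    moreover from this have "staircase (Suc n) (Suc h) v ?w3"
      using p True by simp
    moreover have "?w3 ?p = Suc (w ?p)"
      using p by simp
    moreover have "\<forall>x. x \<notin> subtree (Suc n) v \<longrightarrow> x \<noteq> ?p \<longrightarrow> ?w3 x = w x"
      by simp
    ultimately show ?thesis
      by blast
  next
    case False
    then obtain g where g: "h = Suc g" "0 < g" "g \<le> n"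
      using Suc.prems by (cases h) auto
    have w: "w v = h" "w (4 * v + 1) = 0" "w (4 * v + 2) = 0" "staircase n g ?l w" "staircase n g ?r w"
      using Suc.prems g by auto
    obtain w1 where w1: "reaches w w1" "staircase n h ?r w1" "w1 v = Suc h"
      "\<And>x. x \<notin> subtree n ?r \<Longrightarrow> x \<noteq> v \<Longrightarrow> w1 x = w x"
      using Suc.IH[of ?r g w] g w vV by auto
    define w2 where "w2 = w1(v := h, ?p := Suc (w ?p))"
    have w2: "w2 v = h" "w2 ?p = Suc (w ?p)" "\<And>x. x \<noteq> v \<Longrightarrow> x \<noteq> ?p \<Longrightarrow> w2 x = w1 x"
      using p by (auto simp: w2_def)
    have w1p: "w1 ?p = w ?p"
      using w1(4) p outside by auto
    have step: "?M w1 w2"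
      unfolding w2_def using move_up[of v w1] w1 w1p vV Suc.prems by simp
    have "staircase n g ?l w2 \<longleftrightarrow> staircase n g ?l w"
    proof (rule staircase_cong)
      fix x assume x: "x \<in> subtree n ?l"
      then have "x \<noteq> v" "x \<noteq> ?p" "x \<notin> subtree n ?r"
        using outside p disj by auto
      then show "w2 x = w x" using w1(4) w2(3) by simp
    qed
    then have "staircase n g ?l w2" using w(4) by simp
    then obtain w3 where w3: "reaches w2 w3" "staircase n h ?l w3" "w3 v = Suc h"
      "\<And>x. x \<notin> subtree n ?l \<Longrightarrow> x \<noteq> v \<Longrightarrow> w3 x = w2 x"
      using Suc.IH[of ?l g w2] g vV w2(1) by auto
    have "staircase n h ?r w3 \<longleftrightarrow> staircase n h ?r w1"
    proof (rule staircase_cong)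
      fix x assume x: "x \<in> subtree n ?r"
      then have "x \<noteq> v" "x \<noteq> ?p" "x \<notin> subtree n ?l"
        using outside p disj by auto
      then show "w3 x = w1 x" using w3(4) w2(3) by simp
    qed
    then have "staircase n h ?r w3" using w1(2) by simp
    moreover have "reaches w w3"
      using w1(1) reaches_move[OF step] w3(1) reaches_trans by blast
    moreover have same: "w3 x = w x"
      if "x \<notin> subtree n ?l" "x \<notin> subtree n ?r" "x \<noteq> v" "x \<noteq> ?p" for x
      using that w3(4) w2(3) w1(4) by simp
    moreover have "w3 ?p = Suc (w ?p)"
      using w3(4)[of ?p] w2(2) p outside by auto
    moreover have "staircase (Suc n) (Suc h) v w3"
      using w3(2,3) \<open>staircase n h ?r w3\<close> w(2,3) g same[of "4 * v + 1"] same[of "4 * v + 2"]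
        outside p by simp
    moreover have "\<forall>x. x \<notin> subtree (Suc n) v \<longrightarrow> x \<noteq> ?p \<longrightarrow> w3 x = w x"
      using same by simp
    ultimately show ?thesis
      by blast
  qed
qed simp

text \<open>
  For \<open>h > n\<close> even the lowest level has weight at least 2, so the staircase has no flat part and all
  leaves are used up.
\<close>

lemma staircase_less_parent:
  assumes "staircase n h v w" "n < h" "x \<in> subtree n v" "x \<noteq> v"
  shows "w x = 0 \<or> w x < w (heap_parent x)"
  using assms
proof (induction n arbitrary: h v)
  case (Suc n)
  have child: "w x < w v" if "x = u" "x \<in> subtree n u" "staircase n (h - 1) u w" for u
    using that Suc.prems by (cases n) auto
  show ?case
  proof (cases "x \<in> {4 * v + 3, 4 * v + 4}")
    case True
    have "x \<in> subtree n x"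
      using True Suc.prems(3,4) subtree_ge[of x n "4 * v + 4"]
        subtree_ge[of v n "4 * v + 3"] by (cases n) auto
    then show ?thesis
      using True Suc.prems(1) child[of x] by auto
  next
    case False
    then show ?thesis
      using Suc.prems Suc.IH[of "h - 1" "4 * v + 3"] Suc.IH[of "h - 1" "4 * v + 4"] by auto
  qed
qed simp

lemma raise_root:
  assumes "k \<le> n"
  shows "\<exists>w. unit_acquirable (parent_graph heap_parent (tree_vertices n)) w \<and>
    staircase n (Suc k) 2 w \<and> w 0 = k + 2 \<and> w 1 = 0"
  using assms
proof (induction k)
  case 0
  interpret parent_tree heap_parent "tree_vertices n" by (rule parent_tree_vertices)
  let ?w = "(\<lambda>_ :: nat. 1 :: nat)(1 := 0, 0 := 2)"
  have "unit_acquisition_move T (\<lambda>_. 1) ?w"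
    using move_up[of 1 "\<lambda>_. 1"]
    by (simp add: heap_parent_def tree_vertices_def numeral_2_eq_2)
  then have "unit_acquirable T ?w"
    unfolding unit_acquirable_def by (rule reaches_move)
  moreover have "staircase n (Suc 0) 2 ?w"
    using staircase_initial[of n 2]
    by (subst staircase_cong[of _ _ _ "\<lambda>_. 1"]) (auto dest: subtree_ge)
  moreover have "?w 0 = 0 + 2" "?w 1 = 0"
    by auto
  ultimately show ?case by blast
next
  case (Suc k)
  interpret parent_tree heap_parent "tree_vertices n" by (rule parent_tree_vertices)
  obtain w where w: "unit_acquirable T w" "staircase n (Suc k) 2 w" "w 0 = k + 2" "w 1 = 0"
    using Suc by auto
  have p2: "heap_parent 2 = 0" by (simp add: heap_parent_def)
  obtain w' where w': "reaches w w'" "staircase n (Suc (Suc k)) 2 w'"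
      "w' 0 = Suc (w 0)" "\<forall>x. x \<notin> subtree n 2 \<longrightarrow> x \<noteq> 0 \<longrightarrow> w' x = w x"
    using staircase_raise[OF parent_tree_vertices, of n 2 n "Suc k" w] w Suc.prems
    by (auto simp: tree_vertices_def p2)
  have "1 \<notin> subtree n 2"
    using subtree_ge[of 1 n 2] by auto
  then have "w' 1 = 0" using w w' by simp
  moreover have "unit_acquirable T w'"
    using w(1) w'(1) by (rule reaches_acquirable)
  ultimately show ?case using w w' by auto
qed

theorem theorem3p1:
  fixes d :: nat
  assumes "d > 0"
  shows "\<exists>T :: (nat, nat \<times> nat) pre_digraph.
    undirected_tree T \<and> max_degree T = 5 \<and>
    (\<exists>v \<in> verts T. \<exists>w. unit_acquirable T w \<and> w v \<ge> d) \<and>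
    unit_acquisition_number T = 1"
proof -
  \<comment> \<open>At least two levels are needed to have a vertex of degree 5.\<close>
  define n where "n = d + 1"
  interpret parent_tree heap_parent "tree_vertices n" by (rule parent_tree_vertices)
  obtain w where w: "unit_acquirable T w" "staircase n (Suc n) 2 w" "w 0 = n + 2" "w 1 = 0"
    using raise_root[of n n] by auto
  have "decreasing w"
    unfolding decreasing_def
  proof (intro ballI impI)
    fix x assume x: "x \<in> tree_vertices n" "x \<noteq> 0"
    have "w 2 = n + 1" using w(2) by (simp add: n_def)
    then show "w x = 0 \<or> w x < w (heap_parent x)"
      using x w staircase_less_parent[OF w(2), of x]
      by (cases "x = 2") (auto simp: tree_vertices_def heap_parent_def)
  qed
  then have "unit_acquisition_number T = 1"
    using acquisition_number_eq_1 w(1) by blast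
  moreover have "max_degree T = 5"
    using max_degree_tree assms by (simp add: n_def)
  moreover have "d \<le> w 0"
    using w(3) by (simp add: n_def)
  ultimately show ?thesis
    using undirected_tree_T w(1) root_in_V by (intro exI[of _ T]) auto
qed

end
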